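(* If the self-similar measure $\mu$ is associated with an IFS of finite type and is generalized regular, then $\mu$ is comparable.
   Context: Let $S_j(x)=r_jx+d_j:\mathbb R\to\mathbb R$, $j=0,\dots,k$, with $k\ge 1$ and $0<|r_j|<1$ ($r_j$ may be negative), be an iterated function system (IFS). Let $K$ be its self-similar set, i.e. the unique non-empty compact set with $K=\bigcup_{j=0}^kS_j(K)$; it is assumed throughout that the convex hull of $K$ is $[0,1]$. Given probabilities $p_j>0$ with $\sum_{j=0}^kp_j=1$, the associated self-similar measure $\mu$ is the unique Borel probability measure with $\mu=\sum_{j=0}^kp_j\,\mu\circ S_j^{-1}$. $\Sigma$ is the set of finite words on $\{0,\dots,k\}$. For $\sigma=(\sigma_1,\dots,\sigma_j)$ put $\sigma^-=(\sigma_1,\dots,\sigma_{j-1})$, $S_\sigma=S_{\sigma_1}\circ\cdots\circ S_{\sigma_j}$, $r_\sigma=\prod_i r_{\sigma_i}$, $p_\sigma=\prod_ip_{\sigma_i}$ (for the empty word, $S_\sigma=\mathrm{id}$, $r_\sigma=p_\sigma=1$). Put $r_{\min}=\min_j|r_j|$, $\Lambda_n=\{\sigma\in\Sigma: |r_\sigma|\le r_{\min}^n \text{ and } |r_{\sigma^-}|>r_{\min}^n\}$ for $n\ge 1$, and $\Lambda_0=\{\text{empty word}\}$. Finite type: $\sigma,\tau\in\Lambda_n$ are neighbours if $S_\sigma(0,1)\cap S_\tau(0,1)\ne\emptyset$; $\mathcal N(\sigma)$ is the set of all neighbours of $\sigma$. Words $\sigma\in\Lambda_n$ and $\tau\in\Lambda_m$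 have the same neighbourhood type if there is a map $f(x)=\pm r_{\min}^{m-n}x+c$ with $\{f\circ S_\eta:\eta\in\mathcal N(\sigma)\}=\{S_\nu:\nu\in\mathcal N(\tau)\}$ and $f\circ S_\sigma=S_\tau$. The IFS is of finite type if there are only finitely many neighbourhood types. Net intervals: for $n\ge1$ let $h_1<\dots<h_{s_n}$ be the elements of $\{S_\sigma(0),S_\sigma(1):\sigma\in\Lambda_n\}$ in increasing order, and $\mathcal F_n=\{[h_j,h_{j+1}]: 1\le j\le s_n-1,\ (h_j,h_{j+1})\cap K\ne\emptyset\}$; $\mathcal F_0=\{[0,1]\}$. Elements of $\mathcal F_n$ are net intervals of generation $n$; two net intervals of the same generation are adjacent if they share an endpoint. For $\Delta\in\mathcal F_n$ put $P_n(\Delta)=\sum_{\sigma\in\Lambda_n,\,S_\sigma[0,1]\supseteq\Delta}p_\sigma$. Edge paths: a path of generation $n$ associated with $\sigma\in\Lambda_m$ is a word $\omega$ with $\sigma\omega\in\Lambda_{m+n}$. It is a left-edge path of the net interval $\Delta\in\mathcal F_m$ if, for some such $\sigma\in\Lambda_m$, $\Delta\subseteq S_\sigma[0,1]$ and $\Delta$, $S_\sigma[0,1]$ and $S_{\sigma\omega}[0,1]$ all have the same left endpoint; right-edge paths of $\Delta$ are defined similarly with right endpoints. An edge path of $\Delta$ is a left-edge or right-edge path of $\Delta$. Generalized regular: for a net interval $\Delta$ and $n\in\mathbb N$ let $\Gamma_{\Delta,n}=\sum p_\omega$, the sum over all edge paths $\omega$ of $\Delta$ of generation $n$. Let $R_n=\inf\frac{P_{m+n}(\Delta')}{P_m(\Delta)}$,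 the infimum over all positive integers $m$ and net intervals $\Delta'\subseteq\Delta$ with $\Delta\in\mathcal F_m$, $\Delta'\in\mathcal F_{m+n}$ (one has $R_n>0$). Let $B(n)=\frac1{R_n}\sup_{\Delta}\Gamma_{\Delta,n}$, the supremum over all net intervals. A self-similar measure associated with a finite type IFS is generalized regular if for each $q>1$, $\lim_{n\to\infty}B(n)/q^n=0$. Comparable: a self-similar measure associated with a finite type IFS is comparable if for each $q>1$ there is a constant $c=c(q)>0$ such that for all positive integers $n$ and all adjacent net intervals $\Delta_1,\Delta_2$ of generation $n$, $\frac1cq^{-n}P_n(\Delta_2)\le P_n(\Delta_1)\le cq^nP_n(\Delta_2)$. *)

theory Defs
  imports "HOL-Probability.Probability_Measure" "HOL-Library.Extended_Nonnegative_Real"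
begin

locale self_similar_set =
  fixes k :: nat and r d :: "nat \<Rightarrow> real" and K :: "real set"
  assumes k_ge_1: "k \<ge> 1"
    and ratio: "\<And>j. j \<le> k \<Longrightarrow> 0 < \<bar>r j\<bar> \<and> \<bar>r j\<bar> < 1"
    and compact_K: "compact K"
    and K_nonempty: "K \<noteq> {}"
    and K_invariant: "K = (\<Union>j\<le>k. (\<lambda>x. r j * x + d j) ` K)"
    and hull_K: "convex hull K = {0..1}"
begin

definition S :: "nat \<Rightarrow> real \<Rightarrow> real" where
  "S j x = r j * x + d j"

definition S_word :: "nat list \<Rightarrow> real \<Rightarrow> real" where
  "S_word \<sigma> = foldr (\<lambda>j g. S j \<circ> g) \<sigma> id"

definition r_word :: "nat list \<Rightarrow> real" where
  "r_word \<sigma> = prod_list (map r \<sigma>)"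

definition r_min :: real where
  "r_min = Min ((\<lambda>j. \<bar>r j\<bar>) ` {..k})"

text \<open>\<open>butlast\<close> is the paper's $\sigma^-$. The empty word is never in \<open>\<Lambda> n\<close> for \<open>n \<ge> 1\<close>, so
  the convention \<open>butlast [] = []\<close> plays no role. Each \<open>\<Lambda> n\<close> is finite.\<close>

definition \<Lambda> :: "nat \<Rightarrow> nat list set" where
  "\<Lambda> n = (if n = 0 then {[]}
          else {\<sigma> \<in> lists {..k}. \<bar>r_word \<sigma>\<bar> \<le> r_min ^ n \<and> \<bar>r_word (butlast \<sigma>)\<bar> > r_min ^ n})"

definition neighbours :: "nat \<Rightarrow> nat list \<Rightarrow> nat list set" where
  "neighbours n \<sigma> = {\<tau> \<in> \<Lambda> n. S_word \<sigma> ` {0<..<1} \<inter> S_word \<tau> ` {0<..<1} \<noteq> {}}"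

definition same_nbhd_type :: "((nat \<times> nat list) \<times> (nat \<times> nat list)) set" where
  "same_nbhd_type =
    {((n, \<sigma>), (m, \<tau>)). \<sigma> \<in> \<Lambda> n \<and> \<tau> \<in> \<Lambda> m \<and>
       (\<exists>f s c. s \<in> {1, -1} \<and> f = (\<lambda>x. s * r_min powi (int m - int n) * x + c) \<and>
          {f \<circ> S_word \<eta> | \<eta>. \<eta> \<in> neighbours n \<sigma>} = {S_word \<nu> | \<nu>. \<nu> \<in> neighbours m \<tau>} \<and>
          f \<circ> S_word \<sigma> = S_word \<tau>)}"

definition finite_type :: bool where
  "finite_type \<longleftrightarrow> finite ((SIGMA n:UNIV. \<Lambda> n) // same_nbhd_type)"

definition net_endpoints :: "nat \<Rightarrow> real set" where
  "net_endpoints n = (\<Union>\<sigma>\<in>\<Lambda> n. {S_word \<sigma> 0, S_word \<sigma> 1})"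

text \<open>\<open>net_intervals n\<close> is the paper's $\mathcal F_n$; \<open>a\<close> and \<open>b\<close> below are consecutive elements
  of \<open>net_endpoints n\<close>. The same interval may be a net interval of several generations, so the
  generation is an explicit argument in everything that depends on it.\<close>

definition net_intervals :: "nat \<Rightarrow> real set set" where
  "net_intervals n = (if n = 0 then {{0..1}}
     else {{a..b} | a b. a \<in> net_endpoints n \<and> b \<in> net_endpoints n \<and> a < b \<and>
             net_endpoints n \<inter> {a<..<b} = {} \<and> {a<..<b} \<inter> K \<noteq> {}})"

definition adjacent :: "real set \<Rightarrow> real set \<Rightarrow> bool" where
  "adjacent \<Delta>1 \<Delta>2 \<longleftrightarrow> {Inf \<Delta>1, Sup \<Delta>1} \<inter> {Inf \<Delta>2, Sup \<Delta>2} \<noteq> {}"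

text \<open>Paths of generation \<open>n\<close> of a net interval \<open>\<Delta>\<close> of generation \<open>m\<close>. The endpoints of the
  compact intervals involved are given by \<open>Inf\<close> and \<open>Sup\<close>.\<close>

definition left_edge_paths :: "nat \<Rightarrow> real set \<Rightarrow> nat \<Rightarrow> nat list set" where
  "left_edge_paths m \<Delta> n = {\<omega>. \<exists>\<sigma>\<in>\<Lambda> m. \<sigma> @ \<omega> \<in> \<Lambda> (m + n) \<and> \<Delta> \<subseteq> S_word \<sigma> ` {0..1} \<and>
     Inf (S_word \<sigma> ` {0..1}) = Inf \<Delta> \<and> Inf (S_word (\<sigma> @ \<omega>) ` {0..1}) = Inf \<Delta>}"

definition right_edge_paths :: "nat \<Rightarrow> real set \<Rightarrow> nat \<Rightarrow> nat list set" where
  "right_edge_paths m \<Delta> n = {\<omega>. \<exists>\<sigma>\<in>\<Lambda> m. \<sigma> @ \<omega> \<in> \<Lambda> (m + n) \<and> \<Delta> \<subseteq> S_word \<sigma> ` {0..1} \<and>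
     Sup (S_word \<sigma> ` {0..1}) = Sup \<Delta> \<and> Sup (S_word (\<sigma> @ \<omega>) ` {0..1}) = Sup \<Delta>}"

definition edge_paths :: "nat \<Rightarrow> real set \<Rightarrow> nat \<Rightarrow> nat list set" where
  "edge_paths m \<Delta> n = left_edge_paths m \<Delta> n \<union> right_edge_paths m \<Delta> n"

end

locale self_similar_measure = self_similar_set +
  fixes p :: "nat \<Rightarrow> real" and \<mu> :: "real measure"
  assumes p_pos: "\<And>j. j \<le> k \<Longrightarrow> p j > 0"
    and p_sum: "(\<Sum>j\<le>k. p j) = 1"
    and prob_space_\<mu>: "prob_space \<mu>"
    and sets_\<mu>: "sets \<mu> = sets borel"
    and \<mu>_self_similar: "\<And>A. A \<in> sets borel \<Longrightarrow>
      measure \<mu> A = (\<Sum>j\<le>k. p j * measure \<mu> ((\<lambda>x. r j * x + d j) -` A))"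
begin

definition p_word :: "nat list \<Rightarrow> real" where
  "p_word \<sigma> = prod_list (map p \<sigma>)"

definition P :: "nat \<Rightarrow> real set \<Rightarrow> real" where
  "P n \<Delta> = (\<Sum>\<sigma> | \<sigma> \<in> \<Lambda> n \<and> \<Delta> \<subseteq> S_word \<sigma> ` {0..1}. p_word \<sigma>)"

definition \<Gamma> :: "nat \<Rightarrow> real set \<Rightarrow> nat \<Rightarrow> real" where
  "\<Gamma> m \<Delta> n = (\<Sum>\<omega>\<in>edge_paths m \<Delta> n. p_word \<omega>)"

text \<open>\<open>R\<close> and \<open>B\<close> take values in \<open>ennreal\<close> so that the infimum and the supremum are the true
  ones, and so that \<open>1 / R n\<close> would be \<open>\<infinity>\<close>, not \<open>0\<close>, if \<open>R n\<close> were \<open>0\<close>.\<close>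

definition R :: "nat \<Rightarrow> ennreal" where
  "R n = Inf {ennreal (P (m + n) \<Delta>' / P m \<Delta>) | m \<Delta> \<Delta>'.
     m \<ge> 1 \<and> \<Delta> \<in> net_intervals m \<and> \<Delta>' \<in> net_intervals (m + n) \<and> \<Delta>' \<subseteq> \<Delta>}"

definition B :: "nat \<Rightarrow> ennreal" where
  "B n = 1 / R n * Sup {ennreal (\<Gamma> m \<Delta> n) | m \<Delta>. \<Delta> \<in> net_intervals m}"

definition generalized_regular :: bool where
  "generalized_regular \<longleftrightarrow> (\<forall>q::real. q > 1 \<longrightarrow> (\<lambda>n. B n / ennreal (q ^ n)) \<longlonglongrightarrow> 0)"

definition comparable :: bool where
  "comparable \<longleftrightarrow> (\<forall>q::real. q > 1 \<longrightarrow> (\<exists>c>0. \<forall>n\<ge>1.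
     \<forall>\<Delta>1\<in>net_intervals n. \<forall>\<Delta>2\<in>net_intervals n. adjacent \<Delta>1 \<Delta>2 \<longrightarrow>
       1 / c * (1 / q ^ n) * P n \<Delta>2 \<le> P n \<Delta>1 \<and> P n \<Delta>1 \<le> c * q ^ n * P n \<Delta>2))"

end

end

theory Submission
  imports Defs
begin

text \<open>
  Let two net intervals \<open>\<Delta>1\<close>, \<open>\<Delta>2\<close> of generation \<open>n\<close> meet at a point \<open>b\<close>. A word that covers both
  contributes equally to \<open>P n \<Delta>1\<close> and \<open>P n \<Delta>2\<close>, so the two masses can only differ through the words
  that cover exactly one of them, and the interval of such a word ends at \<open>b\<close>. Comparability
  therefore amounts to a bound on the total mass of these words, the \<open>excess\<close> of \<open>\<Delta>1\<close> over \<open>\<Delta>2\<close>, by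
  a subexponential multiple of \<open>P n \<Delta>2\<close>.

  Go back \<open>N\<close> generations, to \<open>m = n - N\<close>, and let \<open>\<Delta>1'\<close>, \<open>\<Delta>2'\<close> be the net intervals that contain
  \<open>\<Delta>1\<close>, \<open>\<Delta>2\<close>; they are adjacent or equal. A word that separates \<open>\<Delta>1\<close> from \<open>\<Delta>2\<close> has a prefix in
  \<open>\<Lambda> m\<close>. Either the prefix covers \<open>\<Delta>2'\<close> too, and all such words together have mass at most
  \<open>P m \<Delta>2'\<close>; or the prefix separates the parents, and then both the prefix and the word end at
  \<open>b\<close>, so that the suffix is an edge path of \<open>\<Delta>1'\<close>. This gives (\<open>excess_recursion\<close>)
  \<open>excess n \<Delta>1 \<Delta>2 \<le> \<Gamma> m \<Delta>1' N * excess m \<Delta>1' \<Delta>2' + P m \<Delta>2'\<close>.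

  Divide by \<open>P n \<Delta>2 \<ge> R N * P m \<Delta>2'\<close>. The largest ratio \<open>x n\<close> of \<open>excess n \<Delta>1 \<Delta>2\<close> to
  \<open>P n \<Delta>2\<close> satisfies \<open>x n \<le> B N * x (n - N) + 1 / R N\<close>, and generalized regularity provides an \<open>N\<close> with
  \<open>B N \<le> q ^ N\<close> (\<open>generalized_regular_bounds\<close>). Iteration yields \<open>x n = O(q ^ n)\<close>
  (\<open>excess_growth\<close>); the finitely many net intervals of the first \<open>N\<close> generations start it.
\<close>

section \<open>Words and their intervals\<close>

context self_similar_set
begin

lemma S_word_Nil [simp]: "S_word [] = id"
  by (simp add: S_word_def)

lemma S_word_Cons: "S_word (j # \<sigma>) x = S j (S_word \<sigma> x)"
  by (simp add: S_word_def)

lemma S_word_append: "S_word (\<sigma> @ \<tau>) x = S_word \<sigma> (S_word \<tau> x)"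
  by (induction \<sigma>) (simp_all add: S_word_Cons)

lemma r_word_append: "r_word (\<sigma> @ \<tau>) = r_word \<sigma> * r_word \<tau>"
  by (simp add: r_word_def)

lemma r_word_Nil [simp]: "r_word [] = 1"
  by (simp add: r_word_def)

lemma r_word_Cons: "r_word (j # \<sigma>) = r j * r_word \<sigma>"
  by (simp add: r_word_def)

lemma S_word_affine: "S_word \<sigma> x = r_word \<sigma> * x + S_word \<sigma> 0"
proof (induction \<sigma>)
  case (Cons j \<sigma>)
  have "S_word (j # \<sigma>) x = r j * (r_word \<sigma> * x + S_word \<sigma> 0) + d j"
    using Cons by (simp add: S_word_Cons S_def)
  then show ?case by (simp add: S_word_Cons S_def r_word_Cons algebra_simps)
qed simp

lemma abs_r_word_le_1: "\<sigma> \<in> lists {..k} \<Longrightarrow> \<bar>r_word \<sigma>\<bar> \<le> 1"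
proof (induction \<sigma>)
  case (Cons j \<sigma>)
  then show ?case using ratio[of j] by (auto simp: r_word_Cons abs_mult intro: mult_le_one)
qed simp

lemma r_word_nonzero: "\<sigma> \<in> lists {..k} \<Longrightarrow> r_word \<sigma> \<noteq> 0"
proof (induction \<sigma>)
  case (Cons j \<sigma>)
  then show ?case using ratio[of j] by (auto simp: r_word_Cons)
qed simp

lemma abs_r_word_exponential_decay:
  obtains \<rho> where "0 < \<rho>" "\<rho> < 1" "\<And>\<sigma>. \<sigma> \<in> lists {..k} \<Longrightarrow> \<bar>r_word \<sigma>\<bar> \<le> \<rho> ^ length \<sigma>"
proof
  define \<rho> where "\<rho> = Max ((\<lambda>j. \<bar>r j\<bar>) ` {..k})"
  have le: "\<bar>r j\<bar> \<le> \<rho>" if "j \<le> k" for j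
    unfolding \<rho>_def using that by (intro Max_ge) auto
  show "\<rho> < 1" unfolding \<rho>_def using ratio by (subst Max_less_iff) auto
  show pos: "0 < \<rho>" using ratio[of 0] le[of 0] by linarith
  show "\<bar>r_word \<sigma>\<bar> \<le> \<rho> ^ length \<sigma>" if "\<sigma> \<in> lists {..k}" for \<sigma>
    using that
  proof (induction \<sigma>)
    case (Cons j \<sigma>)
    then show ?case using le[of j] pos by (auto simp: r_word_Cons abs_mult intro!: mult_mono)
  qed simp
qed

lemma r_min_bounds: "0 < r_min" "r_min < 1"
proof -
  show "0 < r_min" unfolding r_min_def using ratio by (subst Min_gr_iff) auto
  have "r_min \<le> \<bar>r 0\<bar>" unfolding r_min_def by (intro Min_le) auto
  then show "r_min < 1" using ratio[of 0] by linarith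
qed

lemma eventually_long_words_below:
  obtains L where "\<And>\<sigma>. \<sigma> \<in> lists {..k} \<Longrightarrow> length \<sigma> \<ge> L \<Longrightarrow> \<bar>r_word \<sigma>\<bar> \<le> r_min ^ n"
proof -
  obtain \<rho> where \<rho>: "0 < \<rho>" "\<rho> < 1" "\<And>\<sigma>. \<sigma> \<in> lists {..k} \<Longrightarrow> \<bar>r_word \<sigma>\<bar> \<le> \<rho> ^ length \<sigma>"
    using abs_r_word_exponential_decay by blast
  obtain L where L: "\<rho> ^ L < r_min ^ n"
    using real_arch_pow_inv[of "r_min ^ n" \<rho>] r_min_bounds \<rho> by auto
  show thesis
  proof (rule that[of L])
    fix \<sigma> assume "\<sigma> \<in> lists {..k}" "length \<sigma> \<ge> L"
    then show "\<bar>r_word \<sigma>\<bar> \<le> r_min ^ n"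
      using \<rho>(3)[of \<sigma>] power_decreasing[of L "length \<sigma>" \<rho>] \<rho>(1,2) L by linarith
  qed
qed

lemma \<Lambda>_lists: "\<sigma> \<in> \<Lambda> n \<Longrightarrow> \<sigma> \<in> lists {..k}"
  by (auto simp: \<Lambda>_def split: if_splits)

lemma finite_\<Lambda>: "finite (\<Lambda> n)"
proof (cases "n = 0")
  case False
  obtain L where L: "\<And>\<sigma>. \<sigma> \<in> lists {..k} \<Longrightarrow> length \<sigma> \<ge> L \<Longrightarrow> \<bar>r_word \<sigma>\<bar> \<le> r_min ^ n"
    using eventually_long_words_below by blast
  have "length \<sigma> \<le> L" if "\<sigma> \<in> \<Lambda> n" for \<sigma>
  proof (rule ccontr)
    assume "\<not> length \<sigma> \<le> L"
    moreover have "butlast \<sigma> \<in> lists {..k}"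
      using \<Lambda>_lists[OF that] by (auto dest: in_set_butlastD)
    ultimately have "\<bar>r_word (butlast \<sigma>)\<bar> \<le> r_min ^ n" by (intro L) auto
    then show False using that False by (auto simp: \<Lambda>_def)
  qed
  then have "\<Lambda> n \<subseteq> {\<sigma>. set \<sigma> \<subseteq> {..k} \<and> length \<sigma> \<le> L}"
    using \<Lambda>_lists by (fastforce simp: lists_eq_set)
  then show ?thesis using finite_lists_length_le[of "{..k}" L] finite_subset by blast
qed (simp add: \<Lambda>_def)

lemma \<Lambda>_prefix_free: "\<lbrakk>\<sigma> \<in> \<Lambda> n; \<sigma> @ \<omega> \<in> \<Lambda> n\<rbrakk> \<Longrightarrow> \<omega> = []"
proof (rule ccontr)
  assume a: "\<sigma> \<in> \<Lambda> n" "\<sigma> @ \<omega> \<in> \<Lambda> n" and ne: "\<omega> \<noteq> []"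
  then have n: "n \<noteq> 0" by (cases "n = 0") (auto simp: \<Lambda>_def)
  have "butlast \<omega> \<in> lists {..k}"
    using \<Lambda>_lists[OF a(2)] by (auto dest: in_set_butlastD)
  then have "\<bar>r_word \<sigma>\<bar> * \<bar>r_word (butlast \<omega>)\<bar> \<le> \<bar>r_word \<sigma>\<bar>"
    using abs_r_word_le_1 by (intro mult_left_le) auto
  then show False
    using a n ne by (auto simp: \<Lambda>_def butlast_append r_word_append abs_mult)
qed

lemma \<Lambda>_has_prefix:
  assumes "m \<ge> 1" "\<sigma> \<in> \<Lambda> (m + n)"
  obtains \<tau> \<omega> where "\<tau> \<in> \<Lambda> m" "\<sigma> = \<tau> @ \<omega>"
proof -
  define i where "i = (LEAST i. \<bar>r_word (take i \<sigma>)\<bar> \<le> r_min ^ m)"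
  have "\<bar>r_word \<sigma>\<bar> \<le> r_min ^ (m + n)" using assms by (auto simp: \<Lambda>_def)
  also have "\<dots> \<le> r_min ^ m" using r_min_bounds by (intro power_decreasing) auto
  finally have ex: "\<bar>r_word (take (length \<sigma>) \<sigma>)\<bar> \<le> r_min ^ m" by simp
  let ?Q = "\<lambda>i. \<bar>r_word (take i \<sigma>)\<bar> \<le> r_min ^ m"
  have i: "?Q i" "i \<le> length \<sigma>"
    unfolding i_def using LeastI[of ?Q, OF ex] Least_le[of ?Q, OF ex] by auto
  have "r_min ^ m < 1" using r_min_bounds assms(1) power_strict_decreasing[of 0 m r_min] by simp
  then have "i \<noteq> 0" using i by (intro notI) simp
  then have "\<not> \<bar>r_word (take (i - 1) \<sigma>)\<bar> \<le> r_min ^ m"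
    unfolding i_def by (intro not_less_Least) auto
  then have "take i \<sigma> \<in> \<Lambda> m"
    using i assms \<Lambda>_lists[OF assms(2)] by (auto simp: \<Lambda>_def butlast_take dest: in_set_takeD)
  then show thesis using that[of "take i \<sigma>" "drop i \<sigma>"] by simp
qed

text \<open>The stopping rule that defines \<open>\<Lambda> n\<close> is reached along every infinite branch. This makes
  \<open>\<Lambda> n\<close> a section of the tree of words: whatever can be continued letter by letter (a point of \<open>K\<close>
  followed through nested copies of \<open>K\<close>, an endpoint that stays an endpoint) can be continued up
  to a word of \<open>\<Lambda> n\<close>.\<close>

lemma extend_to_\<Lambda>:
  assumes n: "n \<ge> 1" and step: "\<And>\<tau>. \<tau> \<in> lists {..k} \<Longrightarrow> Q \<tau> \<Longrightarrow> \<exists>j\<le>k. Q (\<tau> @ [j])"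
    and Q: "Q \<sigma>" and \<sigma>: "\<sigma> \<in> lists {..k}" "\<sigma> \<in> \<Lambda> n \<or> \<bar>r_word \<sigma>\<bar> > r_min ^ n"
  obtains \<omega> where "\<sigma> @ \<omega> \<in> \<Lambda> n" "Q (\<sigma> @ \<omega>)"
proof -
  obtain L where L: "\<And>\<sigma>. \<sigma> \<in> lists {..k} \<Longrightarrow> length \<sigma> \<ge> L \<Longrightarrow> \<bar>r_word \<sigma>\<bar> \<le> r_min ^ n"
    using eventually_long_words_below by blast
  have "\<exists>\<omega>. \<sigma> @ \<omega> \<in> \<Lambda> n \<and> Q (\<sigma> @ \<omega>)"
    using Q \<sigma>
  proof (induction "L - length \<sigma>" arbitrary: \<sigma> rule: less_induct)
    case less
    show ?case
    proof (cases "\<sigma> \<in> \<Lambda> n")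
      case True
      then show ?thesis using less.prems by (intro exI[of _ "[]"]) simp
    next
      case False
      then have gt: "\<bar>r_word \<sigma>\<bar> > r_min ^ n" using less.prems by simp
      then have len: "length \<sigma> < L" using L[of \<sigma>] less.prems by fastforce
      obtain j where j: "j \<le> k" "Q (\<sigma> @ [j])" using step less.prems by blast
      have "\<sigma> @ [j] \<in> \<Lambda> n \<or> \<bar>r_word (\<sigma> @ [j])\<bar> > r_min ^ n"
        using gt n j less.prems by (auto simp: \<Lambda>_def)
      moreover have "L - length (\<sigma> @ [j]) < L - length \<sigma>" using len by simp
      moreover have "\<sigma> @ [j] \<in> lists {..k}" using less.prems j by simp
      ultimately obtain \<omega> where "(\<sigma> @ [j]) @ \<omega> \<in> \<Lambda> n \<and> Q ((\<sigma> @ [j]) @ \<omega>)"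
        using less.hyps[of "\<sigma> @ [j]"] j by blast
      then show ?thesis by (intro exI[of _ "j # \<omega>"]) simp
    qed
  qed
  then show thesis using that by blast
qed

lemma \<Lambda>_subdivisible:
  assumes "m \<le> n" "\<sigma> \<in> \<Lambda> m" "n \<ge> 1"
  shows "\<sigma> \<in> \<Lambda> n \<or> \<bar>r_word \<sigma>\<bar> > r_min ^ n"
proof (cases "m = 0")
  case True
  have "r_min ^ n < 1" using r_min_bounds assms(3) power_strict_decreasing[of 0 n r_min] by simp
  then show ?thesis using assms True by (auto simp: \<Lambda>_def)
next
  case False
  have "r_min ^ n \<le> r_min ^ m" using assms r_min_bounds by (intro power_decreasing) auto
  then show ?thesis using assms False by (auto simp: \<Lambda>_def)
qed


section \<open>The attractor and the net endpoints\<close>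

lemma K_subset: "K \<subseteq> {0..1}"
  using hull_subset[of K convex] hull_K by simp

lemma zero_one_in_K: "0 \<in> K" "1 \<in> K"
proof -
  have bdd: "bdd_below K" "bdd_above K" using K_subset by (auto intro: bdd_below_mono bdd_above_mono)
  have in_K: "Inf K \<in> K" "Sup K \<in> K"
    using closed_contains_Inf[of K] closed_contains_Sup[of K] bdd K_nonempty compact_imp_closed[OF compact_K]
    by auto
  have "convex hull K \<subseteq> {Inf K..Sup K}"
    using bdd by (intro hull_minimal) (auto intro: cInf_lower cSup_upper)
  then have "{0..1} \<subseteq> {Inf K..Sup K}" using hull_K by simp
  then have "Inf K \<le> 0" "1 \<le> Sup K" by auto
  moreover have "0 \<le> Inf K" "Sup K \<le> 1" using in_K K_subset by auto
  ultimately show "0 \<in> K" "1 \<in> K" using in_K by auto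
qed

lemma S_in_K: "j \<le> k \<Longrightarrow> x \<in> K \<Longrightarrow> S j x \<in> K"
  using eqset_imp_iff[OF K_invariant, of "S j x"] by (auto simp: S_def)

lemma in_K_preimage: "x \<in> K \<Longrightarrow> \<exists>j\<le>k. \<exists>y\<in>K. x = S j y"
  using eqset_imp_iff[OF K_invariant, of x] by (auto simp: S_def)

lemma S_word_in_K: "\<sigma> \<in> lists {..k} \<Longrightarrow> x \<in> K \<Longrightarrow> S_word \<sigma> x \<in> K"
proof (induction \<sigma>)
  case (Cons j \<sigma>)
  then show ?case using S_in_K by (auto simp: S_word_Cons)
qed simp

lemma K_covered:
  assumes "n \<ge> 1" "x \<in> K"
  obtains \<sigma> where "\<sigma> \<in> \<Lambda> n" "x \<in> S_word \<sigma> ` K"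
proof -
  have step: "\<exists>j\<le>k. x \<in> S_word (\<tau> @ [j]) ` K" if \<tau>: "x \<in> S_word \<tau> ` K" for \<tau>
  proof -
    obtain y where y: "y \<in> K" "x = S_word \<tau> y" using \<tau> by blast
    obtain j z where "j \<le> k" "z \<in> K" "y = S j z" using in_K_preimage[OF y(1)] by blast
    then have "j \<le> k \<and> x = S_word (\<tau> @ [j]) z \<and> z \<in> K"
      using y by (simp add: S_word_append S_word_Cons)
    then show ?thesis by blast
  qed
  have "[] \<in> \<Lambda> n \<or> \<bar>r_word []\<bar> > r_min ^ n"
    using \<Lambda>_subdivisible[of 0 n "[]"] assms(1) by (simp add: \<Lambda>_def[of 0])
  moreover have "x \<in> S_word [] ` K" using assms(2) by simp
  ultimately obtain \<omega> where "[] @ \<omega> \<in> \<Lambda> n" "x \<in> S_word ([] @ \<omega>) ` K"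
    using extend_to_\<Lambda>[of n "\<lambda>\<tau>. x \<in> S_word \<tau> ` K" "[]"] step assms(1) by blast
  then show thesis using that by simp
qed

definition left_end :: "nat list \<Rightarrow> real" where
  "left_end \<sigma> = min (S_word \<sigma> 0) (S_word \<sigma> 1)"

definition right_end :: "nat list \<Rightarrow> real" where
  "right_end \<sigma> = max (S_word \<sigma> 0) (S_word \<sigma> 1)"

lemma S_word_image: "S_word \<sigma> ` {0..1} = {left_end \<sigma>..right_end \<sigma>}"
proof -
  have "S_word \<sigma> = (\<lambda>x. r_word \<sigma> * x + S_word \<sigma> 0)" using S_word_affine by blast
  then have "S_word \<sigma> ` {0..1} = (\<lambda>x. r_word \<sigma> * x + S_word \<sigma> 0) ` {0..1}" by metis
  also have "\<dots> = {left_end \<sigma>..right_end \<sigma>}"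
    using S_word_affine[of \<sigma> 1] by (auto simp: image_affinity_atLeastAtMost left_end_def right_end_def)
  finally show ?thesis .
qed

lemma ends_less: "\<sigma> \<in> lists {..k} \<Longrightarrow> left_end \<sigma> < right_end \<sigma>"
  using S_word_affine[of \<sigma> 1] r_word_nonzero[of \<sigma>] by (auto simp: left_end_def right_end_def)

lemma ends_in_unit:
  assumes "\<sigma> \<in> lists {..k}"
  shows "0 \<le> left_end \<sigma> \<and> right_end \<sigma> \<le> 1"
proof -
  have "S_word \<sigma> 0 \<in> {0..1}" "S_word \<sigma> 1 \<in> {0..1}"
    using S_word_in_K[OF assms] zero_one_in_K K_subset by blast+
  then show ?thesis by (auto simp: left_end_def right_end_def)
qed

lemma ends_mono:
  assumes "\<omega> \<in> lists {..k}"
  shows "left_end \<sigma> \<le> left_end (\<sigma> @ \<omega>) \<and> right_end (\<sigma> @ \<omega>) \<le> right_end \<sigma>"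
proof -
  have "S_word \<omega> 0 \<in> {0..1}" "S_word \<omega> 1 \<in> {0..1}"
    using S_word_in_K[OF assms] zero_one_in_K K_subset by blast+
  then have "S_word (\<sigma> @ \<omega>) 0 \<in> S_word \<sigma> ` {0..1}" "S_word (\<sigma> @ \<omega>) 1 \<in> S_word \<sigma> ` {0..1}"
    by (auto simp: S_word_append)
  then show ?thesis
    unfolding S_word_image by (auto simp: left_end_def[of "\<sigma> @ \<omega>"] right_end_def[of "\<sigma> @ \<omega>"])
qed

lemma net_endpoints_eq: "net_endpoints n = left_end ` \<Lambda> n \<union> right_end ` \<Lambda> n"
proof -
  have "{S_word \<sigma> 0, S_word \<sigma> 1} = {left_end \<sigma>, right_end \<sigma>}" for \<sigma>
    by (auto simp: left_end_def right_end_def min_def max_def)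
  then show ?thesis by (auto simp: net_endpoints_def)
qed

lemma finite_net_endpoints: "finite (net_endpoints n)"
  by (simp add: net_endpoints_eq finite_\<Lambda>)

lemma net_endpoints_in_unit:
  assumes "x \<in> net_endpoints n"
  shows "0 \<le> x \<and> x \<le> 1"
proof -
  obtain \<sigma> where \<sigma>: "\<sigma> \<in> \<Lambda> n" "x = left_end \<sigma> \<or> x = right_end \<sigma>"
    using assms by (auto simp: net_endpoints_eq)
  then show ?thesis
    using ends_in_unit[OF \<Lambda>_lists[OF \<sigma>(1)]] ends_less[OF \<Lambda>_lists[OF \<sigma>(1)]] by auto
qed

text \<open>An extreme point of \<open>[0,1]\<close> can only be the image of an extreme point, because each \<open>S j\<close> is
  affine and maps \<open>[0,1]\<close> into itself.\<close>

lemma unit_endpoint_preimage: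
  assumes "e \<in> {0, 1}"
  shows "\<exists>j\<le>k. \<exists>e'\<in>{0, 1}. e = S j e'"
proof -
  obtain j y where j: "j \<le> k" "y \<in> K" "e = S j y"
    using in_K_preimage[of e] assms zero_one_in_K by auto
  have y: "0 \<le> y" "y \<le> 1" using j K_subset by auto
  have S01: "0 \<le> d j" "d j \<le> 1" "0 \<le> r j + d j" "r j + d j \<le> 1"
    using S_in_K[OF j(1), of 0] S_in_K[OF j(1), of 1] zero_one_in_K K_subset by (auto simp: S_def)
  have "y = 0 \<or> y = 1"
  proof (rule ccontr)
    assume "\<not> (y = 0 \<or> y = 1)"
    then have "0 < y" "0 < 1 - y" using y by auto
    then have "r j > 0 \<Longrightarrow> r j * y > 0 \<and> r j * (1 - y) > 0"
      "r j < 0 \<Longrightarrow> r j * y < 0 \<and> r j * (1 - y) < 0"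
      by (auto intro: mult_neg_pos)
    moreover have "r j * (1 - y) = r j - r j * y" by (simp add: algebra_simps)
    moreover have "r j \<noteq> 0" using ratio[OF j(1)] by auto
    moreover have "r j * y + d j = 0 \<or> r j * y + d j = 1" using assms j by (auto simp: S_def)
    ultimately show False using S01 by linarith
  qed
  then show ?thesis using j by blast
qed

lemma net_endpoints_mono:
  assumes "m \<le> n" "n \<ge> 1"
  shows "net_endpoints m \<subseteq> net_endpoints n"
proof
  fix x assume "x \<in> net_endpoints m"
  then obtain \<sigma> where \<sigma>: "\<sigma> \<in> \<Lambda> m" "x \<in> S_word \<sigma> ` {0, 1}" by (auto simp: net_endpoints_def)
  have step: "\<exists>j\<le>k. x \<in> S_word (\<tau> @ [j]) ` {0, 1}" if \<tau>: "x \<in> S_word \<tau> ` {0, 1}" for \<tau>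
  proof -
    obtain e where e: "e \<in> {0, 1}" "x = S_word \<tau> e" using \<tau> by blast
    obtain j e' where "j \<le> k" "e' \<in> {0, 1}" "e = S j e'" using unit_endpoint_preimage[OF e(1)] by blast
    then have "j \<le> k \<and> x = S_word (\<tau> @ [j]) e' \<and> e' \<in> {0, 1}"
      using e by (simp add: S_word_append S_word_Cons)
    then show ?thesis by blast
  qed
  obtain \<omega> where "\<sigma> @ \<omega> \<in> \<Lambda> n" "x \<in> S_word (\<sigma> @ \<omega>) ` {0, 1}"
    using extend_to_\<Lambda>[of n "\<lambda>\<tau>. x \<in> S_word \<tau> ` {0, 1}" \<sigma>] step assms \<sigma> \<Lambda>_subdivisible[OF assms(1) \<sigma>(1) assms(2)]
      \<Lambda>_lists[OF \<sigma>(1)] by blast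
  then show "x \<in> net_endpoints n" by (auto simp: net_endpoints_def)
qed

lemma zero_one_net_endpoints: "n \<ge> 1 \<Longrightarrow> 0 \<in> net_endpoints n \<and> 1 \<in> net_endpoints n"
  using net_endpoints_mono[of 0 n] by (auto simp: net_endpoints_def[of 0] \<Lambda>_def[of 0])


section \<open>Net intervals\<close>

lemma net_intervalE:
  assumes "\<Delta> \<in> net_intervals n" "n \<ge> 1"
  obtains a b where "\<Delta> = {a..b}" "a < b" "a \<in> net_endpoints n" "b \<in> net_endpoints n"
    "\<And>x. x \<in> net_endpoints n \<Longrightarrow> x \<le> a \<or> b \<le> x" "{a<..<b} \<inter> K \<noteq> {}"
proof -
  obtain a b where ab: "\<Delta> = {a..b}" "a < b" "a \<in> net_endpoints n" "b \<in> net_endpoints n"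
    "net_endpoints n \<inter> {a<..<b} = {}" "{a<..<b} \<inter> K \<noteq> {}"
    using assms by (auto simp: net_intervals_def)
  moreover have "x \<le> a \<or> b \<le> x" if "x \<in> net_endpoints n" for x
    using ab(5) that by (meson disjoint_iff greaterThanLessThan_iff leI)
  ultimately show thesis using that by blast
qed

lemma finite_net_intervals: "finite (net_intervals n)"
proof (rule finite_subset)
  show "net_intervals n \<subseteq> insert {0..1} ((\<lambda>(a, b). {a..b}) ` (net_endpoints n \<times> net_endpoints n))"
    by (auto simp: net_intervals_def image_iff)
qed (simp add: finite_net_endpoints)

text \<open>The endpoints of the intervals of \<open>\<Lambda> n\<close> never fall inside a net interval of generation \<open>n\<close>, so
  any overlap is a full covering.\<close>

lemma covers_if_overlaps:
  assumes "{a..b} \<in> net_intervals n" "n \<ge> 1" "\<sigma> \<in> \<Lambda> n" "max a (left_end \<sigma>) < min b (right_end \<sigma>)"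
  shows "{a..b} \<subseteq> S_word \<sigma> ` {0..1}"
proof -
  obtain a' b' where "{a..b} = {a'..b'}" "a' < b'"
    "\<And>x. x \<in> net_endpoints n \<Longrightarrow> x \<le> a' \<or> b' \<le> x"
    using net_intervalE[OF assms(1,2)] by metis
  moreover have "left_end \<sigma> \<in> net_endpoints n" "right_end \<sigma> \<in> net_endpoints n"
    using assms by (auto simp: net_endpoints_eq)
  ultimately have "left_end \<sigma> \<le> a' \<or> b' \<le> left_end \<sigma>" "right_end \<sigma> \<le> a' \<or> b' \<le> right_end \<sigma>" "a = a'" "b = b'"
    by (auto simp: Icc_eq_Icc)
  then show ?thesis using assms(4) by (auto simp: S_word_image)
qed

lemma net_interval_covered:
  assumes "\<Delta> \<in> net_intervals n" "n \<ge> 1"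
  obtains \<sigma> where "\<sigma> \<in> \<Lambda> n" "\<Delta> \<subseteq> S_word \<sigma> ` {0..1}"
proof -
  obtain a b where ab: "\<Delta> = {a..b}" "{a<..<b} \<inter> K \<noteq> {}"
    using net_intervalE[OF assms] by metis
  then obtain x where x: "a < x" "x < b" "x \<in> K" by auto
  obtain \<sigma> where \<sigma>: "\<sigma> \<in> \<Lambda> n" "x \<in> S_word \<sigma> ` K" using K_covered[OF assms(2) x(3)] by blast
  then have "x \<in> S_word \<sigma> ` {0..1}" using K_subset by blast
  then have "max a (left_end \<sigma>) < min b (right_end \<sigma>)"
    using x ends_less[OF \<Lambda>_lists[OF \<sigma>(1)]] by (auto simp: S_word_image)
  then show thesis using that \<sigma> covers_if_overlaps assms ab by blast
qed

lemma net_intervals_overlap_eq: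
  assumes "{a..b} \<in> net_intervals n" "{a'..b'} \<in> net_intervals n" "n \<ge> 1" "max a a' < min b b'"
  shows "a = a' \<and> b = b'"
proof -
  obtain u v where "{a..b} = {u..v}" "u < v" "u \<in> net_endpoints n" "v \<in> net_endpoints n"
    "\<And>x. x \<in> net_endpoints n \<Longrightarrow> x \<le> u \<or> v \<le> x"
    using net_intervalE[OF assms(1,3)] by metis
  moreover obtain u' v' where "{a'..b'} = {u'..v'}" "u' < v'" "u' \<in> net_endpoints n" "v' \<in> net_endpoints n"
    "\<And>x. x \<in> net_endpoints n \<Longrightarrow> x \<le> u' \<or> v' \<le> x"
    using net_intervalE[OF assms(2,3)] by metis
  ultimately have "u \<le> u' \<or> v' \<le> u" "v \<le> u' \<or> v' \<le> v" "u' \<le> u \<or> v \<le> u'" "v' \<le> u \<or> v \<le> v'"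
    "a = u" "b = v" "a' = u'" "b' = v'"
    by (auto simp: Icc_eq_Icc)
  then show ?thesis using assms(4) by linarith
qed

text \<open>The net endpoints of generation \<open>m\<close> persist, so none of them is interior to a net interval of a
  later generation; the nearest ones on either side bound the parent.\<close>

lemma net_interval_parent:
  assumes "\<Delta> \<in> net_intervals (m + n)" "m \<ge> 1"
  obtains \<Delta>' where "\<Delta>' \<in> net_intervals m" "\<Delta> \<subseteq> \<Delta>'"
proof -
  have "m + n \<ge> 1" using assms by simp
  then obtain a b where ab: "\<Delta> = {a..b}" "a < b" "a \<in> net_endpoints (m + n)" "b \<in> net_endpoints (m + n)"
    "\<And>x. x \<in> net_endpoints (m + n) \<Longrightarrow> x \<le> a \<or> b \<le> x" "{a<..<b} \<inter> K \<noteq> {}"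
    using net_intervalE[OF assms(1)] by metis
  define A where "A = {x \<in> net_endpoints m. x \<le> a}"
  define C where "C = {x \<in> net_endpoints m. b \<le> x}"
  have fin: "finite A" "finite C" using finite_net_endpoints by (auto simp: A_def C_def)
  have ne: "A \<noteq> {}" "C \<noteq> {}"
    using zero_one_net_endpoints[OF assms(2)] net_endpoints_in_unit ab(3,4) by (auto simp: A_def C_def)
  have ends: "Max A \<in> A" "Min C \<in> C" using Max_in[OF fin(1) ne(1)] Min_in[OF fin(2) ne(2)] .
  have *: "Max A \<le> a" "b \<le> Min C" "Max A \<in> net_endpoints m" "Min C \<in> net_endpoints m"
    using ends by (auto simp: A_def C_def)
  have "x \<le> Max A \<or> Min C \<le> x" if x: "x \<in> net_endpoints m" for x
  proof -
    have "x \<in> net_endpoints (m + n)" using net_endpoints_mono[of m "m + n"] assms(2) x by auto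
    then have "x \<in> A \<or> x \<in> C" using ab(5) x by (auto simp: A_def C_def)
    then show ?thesis using fin by auto
  qed
  then have "net_endpoints m \<inter> {Max A<..<Min C} = {}" by fastforce
  moreover have "{a<..<b} \<subseteq> {Max A<..<Min C}" using *(1,2) by auto
  then have "{Max A<..<Min C} \<inter> K \<noteq> {}" using ab(6) by blast
  moreover have "Max A < Min C" using *(1,2) ab(2) by linarith
  ultimately have "{Max A..Min C} \<in> net_intervals m"
    using *(3,4) assms(2) unfolding net_intervals_def by auto
  then show thesis using that[of "{Max A..Min C}"] * ab(1) by auto
qed

text \<open>Two net intervals of one generation do not overlap, so adjacency leaves three
  configurations; equality is one of them because every net interval shares its endpoints with
  itself.\<close>

lemma adjacent_cases [consumes 4, case_names same left right]:
  assumes "\<Delta>1 \<in> net_intervals n" "\<Delta>2 \<in> net_intervals n" "n \<ge> 1" "adjacent \<Delta>1 \<Delta>2"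
  obtains (same) "\<Delta>1 = \<Delta>2"
    | (left) a b c where "\<Delta>1 = {a..b}" "\<Delta>2 = {b..c}" "a < b" "b < c"
    | (right) a b c where "\<Delta>1 = {b..c}" "\<Delta>2 = {a..b}" "a < b" "b < c"
proof -
  obtain a b where 1: "\<Delta>1 = {a..b}" "a < b" using net_intervalE[OF assms(1,3)] by metis
  obtain a' b' where 2: "\<Delta>2 = {a'..b'}" "a' < b'" using net_intervalE[OF assms(2,3)] by metis
  have adj: "a = a' \<or> a = b' \<or> b = a' \<or> b = b'" using assms(4) 1 2 by (auto simp: adjacent_def)
  show thesis
  proof (cases "max a a' < min b b'")
    case True
    then have "a = a' \<and> b = b'" using net_intervals_overlap_eq assms 1 2 by blast
    then show thesis using same 1 2 by simp
  next
    case False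
    then have "b = a' \<or> a = b'" using adj 1 2 by linarith
    then show thesis using left[of a b b'] right[of a b a'] 1 2 by blast
  qed
qed

lemma adjacent_sym: "adjacent \<Delta>1 \<Delta>2 \<longleftrightarrow> adjacent \<Delta>2 \<Delta>1"
  by (auto simp: adjacent_def)

text \<open>If the shared endpoint is already a net endpoint of the earlier generation, the parents meet
  there; otherwise it is interior to a single parent.\<close>

lemma adjacent_parents:
  assumes "\<Delta>1 \<in> net_intervals (m + n)" "\<Delta>2 \<in> net_intervals (m + n)" "m \<ge> 1"
    and "\<Delta>1' \<in> net_intervals m" "\<Delta>2' \<in> net_intervals m" "\<Delta>1 \<subseteq> \<Delta>1'" "\<Delta>2 \<subseteq> \<Delta>2'"
    and "adjacent \<Delta>1 \<Delta>2"
  shows "adjacent \<Delta>1' \<Delta>2'"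
proof -
  have ordered: "adjacent X' Y'"
    if XY: "{a..b} \<in> net_intervals (m + n)" "{b..c} \<in> net_intervals (m + n)" "a < b" "b < c"
      and X': "X' \<in> net_intervals m" "{a..b} \<subseteq> X'" and Y': "Y' \<in> net_intervals m" "{b..c} \<subseteq> Y'"
    for a b c X' Y'
  proof -
    obtain u v where u: "X' = {u..v}" "u < v" "v \<in> net_endpoints m"
      "\<And>x. x \<in> net_endpoints m \<Longrightarrow> x \<le> u \<or> v \<le> x"
      using net_intervalE[OF X'(1) assms(3)] by metis
    obtain s t where s: "Y' = {s..t}" "s < t" "s \<in> net_endpoints m"
      "\<And>x. x \<in> net_endpoints m \<Longrightarrow> x \<le> s \<or> t \<le> x"
      using net_intervalE[OF Y'(1) assms(3)] by metis
    have le: "u \<le> a" "b \<le> v" "s \<le> b" "c \<le> t" using X' Y' u(1) s(1) XY by auto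
    show ?thesis
    proof (cases "max u s < min v t")
      case True
      then have "u = s \<and> v = t" using net_intervals_overlap_eq assms(3) X' Y' u s by blast
      then show ?thesis using u s by (simp add: adjacent_def)
    next
      case False
      then have "v = s" using le u s XY by linarith
      then show ?thesis using u s by (simp add: adjacent_def)
    qed
  qed
  have n: "m + n \<ge> 1" using assms(3) by simp
  from assms(1,2) n assms(8) show ?thesis
  proof (cases rule: adjacent_cases)
    case same
    have "\<Delta>1' = \<Delta>2'"
    proof -
      obtain a b where 1: "\<Delta>1 = {a..b}" "a < b" using net_intervalE[OF assms(1) n] by metis
      obtain u v where u: "\<Delta>1' = {u..v}" "u < v" using net_intervalE[OF assms(4,3)] by metis
      obtain s t where s: "\<Delta>2' = {s..t}" "s < t" using net_intervalE[OF assms(5,3)] by metis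
      have "max u s < min v t" using assms(6,7) same 1 u s by auto
      then show ?thesis using net_intervals_overlap_eq assms(3-5) u s by blast
    qed
    then show ?thesis by (simp add: adjacent_def)
  next
    case (left a b c)
    then show ?thesis using ordered assms by blast
  next
    case (right a b c)
    then show ?thesis using ordered[of a b c \<Delta>2' \<Delta>1'] assms adjacent_sym by blast
  qed
qed

lemma prefix_covers_parent:
  assumes "\<Delta> \<in> net_intervals (m + n)" "\<Delta>' \<in> net_intervals m" "m \<ge> 1" "\<Delta> \<subseteq> \<Delta>'"
    and "\<sigma> \<in> \<Lambda> m" "\<sigma> @ \<omega> \<in> \<Lambda> (m + n)" "\<Delta> \<subseteq> S_word (\<sigma> @ \<omega>) ` {0..1}"
  shows "\<Delta>' \<subseteq> S_word \<sigma> ` {0..1}"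
proof -
  have "m + n \<ge> 1" using assms(3) by simp
  then obtain a b where ab: "\<Delta> = {a..b}" "a < b" using net_intervalE[OF assms(1)] by metis
  obtain u v where u: "\<Delta>' = {u..v}" "u < v" using net_intervalE[OF assms(2,3)] by metis
  have "\<omega> \<in> lists {..k}" using \<Lambda>_lists[OF assms(6)] by auto
  then have "left_end \<sigma> \<le> a" "b \<le> right_end \<sigma>"
    using assms(7) ends_mono[of \<omega> \<sigma>] ab by (auto simp: S_word_image)
  moreover have "u \<le> a" "b \<le> v" using assms(4) ab u by auto
  ultimately show ?thesis using covers_if_overlaps u assms ab by auto
qed

text \<open>This is the reason why edge paths occur. If \<open>\<sigma> @ \<omega>\<close> covers one of two adjacent net intervals
  but not the other, its interval ends at their common endpoint. If the prefix \<open>\<sigma>\<close> separates the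
  two parents as well, the interval of \<open>\<sigma>\<close> ends at the same point, since it would otherwise reach
  into the second parent and hence cover it.\<close>

lemma separating_suffix_is_edge_path:
  assumes \<Delta>: "\<Delta>1 \<in> net_intervals (m + n)" "\<Delta>2 \<in> net_intervals (m + n)" "m \<ge> 1" "adjacent \<Delta>1 \<Delta>2"
    and \<Delta>': "\<Delta>1' \<in> net_intervals m" "\<Delta>2' \<in> net_intervals m" "\<Delta>1 \<subseteq> \<Delta>1'" "\<Delta>2 \<subseteq> \<Delta>2'"
    and \<sigma>: "\<sigma> \<in> \<Lambda> m" "\<sigma> @ \<omega> \<in> \<Lambda> (m + n)"
    and sep: "\<Delta>1 \<subseteq> S_word (\<sigma> @ \<omega>) ` {0..1}" "\<not> \<Delta>2 \<subseteq> S_word (\<sigma> @ \<omega>) ` {0..1}"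
    and sep': "\<not> \<Delta>2' \<subseteq> S_word \<sigma> ` {0..1}"
  shows "\<omega> \<in> edge_paths m \<Delta>1' n"
proof -
  have mn: "m + n \<ge> 1" using \<Delta>(3) by simp
  have cov: "\<Delta>1' \<subseteq> S_word \<sigma> ` {0..1}" using prefix_covers_parent[OF \<Delta>(1) \<Delta>'(1) \<Delta>(3) \<Delta>'(3) \<sigma> sep(1)] .
  obtain u v where u: "\<Delta>1' = {u..v}" "u < v" using net_intervalE[OF \<Delta>'(1) \<Delta>(3)] by metis
  obtain s t where s: "\<Delta>2' = {s..t}" "s < t" using net_intervalE[OF \<Delta>'(2) \<Delta>(3)] by metis
  have "\<omega> \<in> lists {..k}" using \<Lambda>_lists[OF \<sigma>(2)] by auto
  note mono = ends_mono[OF this, of \<sigma>]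
  note less = ends_less[OF \<Lambda>_lists[OF \<sigma>(1)]] ends_less[OF \<Lambda>_lists[OF \<sigma>(2)]]
  have uv: "left_end \<sigma> \<le> u" "v \<le> right_end \<sigma>" using cov u by (auto simp: S_word_image)
  have no_overlap: "\<not> max s (left_end \<sigma>) < min t (right_end \<sigma>)"
    using covers_if_overlaps[of s t m \<sigma>] s \<Delta>' \<Delta> \<sigma> sep' by blast
  from \<Delta>(1,2) mn \<Delta>(4) show ?thesis
  proof (cases rule: adjacent_cases)
    case same
    then show ?thesis using sep by simp
  next
    case (left a b c)
    have no_overlap': "\<not> max b (left_end (\<sigma> @ \<omega>)) < min c (right_end (\<sigma> @ \<omega>))"
      using covers_if_overlaps[of b c "m + n" "\<sigma> @ \<omega>"] left \<Delta> \<sigma> sep mn by blast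
    have "left_end (\<sigma> @ \<omega>) \<le> a" "b \<le> right_end (\<sigma> @ \<omega>)"
      using sep left by (auto simp: S_word_image)
    moreover have "u \<le> a" "b \<le> v" "s \<le> b" "c \<le> t" using \<Delta>' left u s by auto
    ultimately have "right_end (\<sigma> @ \<omega>) = b" "right_end \<sigma> = b" "v = b"
      using no_overlap no_overlap' mono uv left by auto
    then have "\<omega> \<in> right_edge_paths m \<Delta>1' n"
      unfolding right_edge_paths_def using \<sigma> cov u less by (auto simp: S_word_image)
    then show ?thesis by (simp add: edge_paths_def)
  next
    case (right a b c)
    have no_overlap': "\<not> max a (left_end (\<sigma> @ \<omega>)) < min b (right_end (\<sigma> @ \<omega>))"
      using covers_if_overlaps[of a b "m + n" "\<sigma> @ \<omega>"] right \<Delta> \<sigma> sep mn by blast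
    have "left_end (\<sigma> @ \<omega>) \<le> b" "c \<le> right_end (\<sigma> @ \<omega>)"
      using sep right by (auto simp: S_word_image)
    moreover have "u \<le> b" "c \<le> v" "s \<le> a" "b \<le> t" using \<Delta>' right u s by auto
    ultimately have "left_end (\<sigma> @ \<omega>) = b" "left_end \<sigma> = b" "u = b"
      using no_overlap no_overlap' mono uv right by auto
    then have "\<omega> \<in> left_edge_paths m \<Delta>1' n"
      unfolding left_edge_paths_def using \<sigma> cov u less by (auto simp: S_word_image)
    then show ?thesis by (simp add: edge_paths_def)
  qed
qed

lemma finite_edge_paths: "finite (edge_paths m \<Delta> n)"
proof (rule finite_subset)
  show "edge_paths m \<Delta> n \<subseteq> (\<Union>\<sigma>\<in>\<Lambda> m. (@) \<sigma> -` \<Lambda> (m + n))"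
    by (auto simp: edge_paths_def left_edge_paths_def right_edge_paths_def)
  show "finite (\<Union>\<sigma>\<in>\<Lambda> m. (@) \<sigma> -` \<Lambda> (m + n))"
    using finite_\<Lambda> by (intro finite_UN_I finite_vimageI) (auto simp: inj_def)
qed

lemma edge_paths_lists: "\<omega> \<in> edge_paths m \<Delta> n \<Longrightarrow> \<omega> \<in> lists {..k}"
  by (auto simp: edge_paths_def left_edge_paths_def right_edge_paths_def dest!: \<Lambda>_lists)

lemma unit_interval_has_edge_path:
  assumes "n \<ge> 1"
  shows "edge_paths 0 {0..1} n \<noteq> {}"
proof -
  obtain \<omega> where \<omega>: "\<omega> \<in> \<Lambda> n" "left_end \<omega> = 0 \<or> right_end \<omega> = 0"
    using zero_one_net_endpoints[OF assms] by (auto simp: net_endpoints_eq)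
  have "left_end \<omega> = 0" "0 < right_end \<omega>"
    using \<omega> ends_less[OF \<Lambda>_lists[OF \<omega>(1)]] ends_in_unit[OF \<Lambda>_lists[OF \<omega>(1)]] by auto
  then have "\<omega> \<in> left_edge_paths 0 {0..1} n"
    using \<omega> by (auto simp: left_edge_paths_def \<Lambda>_def[of 0] S_word_image) 
  then show ?thesis by (auto simp: edge_paths_def)
qed

end


section \<open>Masses of words\<close>

context self_similar_measure
begin

lemma p_word_append: "p_word (\<sigma> @ \<tau>) = p_word \<sigma> * p_word \<tau>"
  by (simp add: p_word_def)

lemma p_word_pos: "\<sigma> \<in> lists {..k} \<Longrightarrow> p_word \<sigma> > 0"
proof (induction \<sigma>)
  case (Cons j \<sigma>)
  then show ?case using p_pos[of j] by (auto simp: p_word_def)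
qed (simp add: p_word_def)

text \<open>Kraft's inequality: the cylinders of a prefix-free set of words are disjoint.\<close>

lemma sum_p_word_prefix_free_le_1:
  assumes "finite A" "A \<subseteq> lists {..k}" "\<And>\<sigma> \<omega>. \<sigma> \<in> A \<Longrightarrow> \<sigma> @ \<omega> \<in> A \<Longrightarrow> \<omega> = []"
  shows "(\<Sum>\<sigma>\<in>A. p_word \<sigma>) \<le> 1"
proof -
  obtain L where "\<And>\<sigma>. \<sigma> \<in> A \<Longrightarrow> length \<sigma> \<le> L"
    using finite_nat_set_iff_bounded_le[of "length ` A"] assms(1) by auto
  then show ?thesis using assms
  proof (induction L arbitrary: A)
    case (0 A)
    then have "A \<subseteq> {[]}" by auto
    then have "sum p_word A \<le> sum p_word {[]}" by (intro sum_mono2) (auto simp: p_word_def)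
    then show ?case by (simp add: p_word_def)
  next
    case (Suc L A)
    show ?case
    proof (cases "[] \<in> A")
      case True
      then have "A = {[]}" using Suc.prems(4)[of "[]"] by auto
      then show ?thesis by (simp add: p_word_def)
    next
      case False
      define T where "T j = {\<sigma>. j # \<sigma> \<in> A}" for j
      have fin: "finite (T j)" for j
        using finite_vimageI[of A "(#) j"] Suc.prems(2) by (simp add: T_def vimage_def)
      have le: "sum p_word (T j) \<le> 1" for j
      proof (rule Suc.IH)
        show "length \<sigma> \<le> L" if "\<sigma> \<in> T j" for \<sigma> using Suc.prems(1)[of "j # \<sigma>"] that by (simp add: T_def)
        show "finite (T j)" by (rule fin)
        show "T j \<subseteq> lists {..k}" using Suc.prems(3) by (auto simp: T_def)
        show "\<omega> = []" if "\<sigma> \<in> T j" "\<sigma> @ \<omega> \<in> T j" for \<sigma> \<omega>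
          using Suc.prems(4)[of "j # \<sigma>" \<omega>] that by (simp add: T_def)
      qed
      have "A = (\<Union>j\<le>k. (#) j ` T j)"
      proof (intro equalityI subsetI)
        fix \<sigma> assume \<sigma>: "\<sigma> \<in> A"
        moreover have "\<sigma> \<in> lists {..k}" using \<sigma> Suc.prems(3) by blast
        ultimately obtain j \<tau> where "\<sigma> = j # \<tau>" "j \<le> k" "\<tau> \<in> T j"
          using False by (cases \<sigma>) (auto simp: T_def)
        then show "\<sigma> \<in> (\<Union>j\<le>k. (#) j ` T j)" by blast
      qed (auto simp: T_def)
      then have "sum p_word A = sum p_word (\<Union>j\<le>k. (#) j ` T j)" by simp
      also have "\<dots> = (\<Sum>j\<le>k. sum p_word ((#) j ` T j))"
        using fin by (intro sum.UNION_disjoint) auto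
      also have "\<dots> = (\<Sum>j\<le>k. p j * sum p_word (T j))"
        by (simp add: sum.reindex sum_distrib_left p_word_def)
      also have "\<dots> \<le> (\<Sum>j\<le>k. p j * 1)"
        using le p_pos by (intro sum_mono mult_left_mono) (auto intro: less_imp_le)
      finally show ?thesis using p_sum by simp
    qed
  qed
qed

lemma sum_suffixes_le_1: "(\<Sum>\<omega> | \<sigma> @ \<omega> \<in> \<Lambda> n. p_word \<omega>) \<le> 1"
proof (rule sum_p_word_prefix_free_le_1)
  show "finite {\<omega>. \<sigma> @ \<omega> \<in> \<Lambda> n}"
    using finite_vimageI[of "\<Lambda> n" "(@) \<sigma>"] finite_\<Lambda> by (simp add: vimage_def inj_def)
  show "{\<omega>. \<sigma> @ \<omega> \<in> \<Lambda> n} \<subseteq> lists {..k}" by (auto dest!: \<Lambda>_lists)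
  show "\<omega>' = []" if "\<omega> \<in> {\<omega>. \<sigma> @ \<omega> \<in> \<Lambda> n}" "\<omega> @ \<omega>' \<in> {\<omega>. \<sigma> @ \<omega> \<in> \<Lambda> n}" for \<omega> \<omega>'
    using \<Lambda>_prefix_free[of "\<sigma> @ \<omega>" n \<omega>'] that by simp
qed

lemma P_pos:
  assumes "\<Delta> \<in> net_intervals n" "n \<ge> 1"
  shows "P n \<Delta> > 0"
proof -
  obtain \<sigma> where "\<sigma> \<in> \<Lambda> n" "\<Delta> \<subseteq> S_word \<sigma> ` {0..1}" using net_interval_covered[OF assms] by blast
  then show ?thesis unfolding P_def using finite_\<Lambda> \<Lambda>_lists p_word_pos
    by (intro sum_pos) auto
qed

lemma \<Gamma>_nonneg: "\<Gamma> m \<Delta> n \<ge> 0"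
  unfolding \<Gamma>_def using edge_paths_lists p_word_pos by (intro sum_nonneg) (auto intro: less_imp_le)

definition excess :: "nat \<Rightarrow> real set \<Rightarrow> real set \<Rightarrow> real" where
  "excess n \<Delta>1 \<Delta>2 =
     (\<Sum>\<sigma> | \<sigma> \<in> \<Lambda> n \<and> \<Delta>1 \<subseteq> S_word \<sigma> ` {0..1} \<and> \<not> \<Delta>2 \<subseteq> S_word \<sigma> ` {0..1}. p_word \<sigma>)"

lemma excess_le_1: "excess n \<Delta>1 \<Delta>2 \<le> 1"
proof -
  have "excess n \<Delta>1 \<Delta>2 \<le> sum p_word (\<Lambda> n)"
    unfolding excess_def using finite_\<Lambda> p_word_pos \<Lambda>_lists
    by (intro sum_mono2) (auto intro: less_imp_le)
  also have "\<dots> \<le> 1" using sum_suffixes_le_1[of "[]" n] by simp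
  finally show ?thesis .
qed

lemma P_le_P_plus_excess: "P n \<Delta>1 \<le> P n \<Delta>2 + excess n \<Delta>1 \<Delta>2"
proof -
  let ?c = "\<lambda>\<Delta> \<sigma>. \<Delta> \<subseteq> S_word \<sigma> ` {0..1}"
  have "P n \<Delta>1 \<le> sum p_word ({\<sigma> \<in> \<Lambda> n. ?c \<Delta>2 \<sigma>} \<union> {\<sigma> \<in> \<Lambda> n. ?c \<Delta>1 \<sigma> \<and> \<not> ?c \<Delta>2 \<sigma>})"
    unfolding P_def using finite_\<Lambda> p_word_pos \<Lambda>_lists
    by (intro sum_mono2) (auto intro: less_imp_le)
  also have "\<dots> = P n \<Delta>2 + excess n \<Delta>1 \<Delta>2"
    unfolding P_def excess_def using finite_\<Lambda> by (intro sum.union_disjoint) auto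
  finally show ?thesis .
qed

text \<open>The excess is split according to the prefix \<open>\<sigma>\<close> of generation \<open>m\<close>. If \<open>\<sigma>\<close> separates the
  parents, its suffixes are edge paths, which gives the first term; if it covers both parents, its
  suffixes have total mass at most 1 by Kraft's inequality, which gives the second term.\<close>

lemma excess_recursion:
  assumes \<Delta>: "\<Delta>1 \<in> net_intervals (m + n)" "\<Delta>2 \<in> net_intervals (m + n)" "m \<ge> 1" "adjacent \<Delta>1 \<Delta>2"
    and \<Delta>': "\<Delta>1' \<in> net_intervals m" "\<Delta>2' \<in> net_intervals m" "\<Delta>1 \<subseteq> \<Delta>1'" "\<Delta>2 \<subseteq> \<Delta>2'"
  shows "excess (m + n) \<Delta>1 \<Delta>2 \<le> \<Gamma> m \<Delta>1' n * excess m \<Delta>1' \<Delta>2' + P m \<Delta>2'"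
proof -
  let ?c = "\<lambda>\<Delta> \<sigma>. \<Delta> \<subseteq> S_word \<sigma> ` {0..1}"
  define A where "A = {\<sigma> \<in> \<Lambda> m. ?c \<Delta>1' \<sigma> \<and> \<not> ?c \<Delta>2' \<sigma>}"
  define C where "C = {\<sigma> \<in> \<Lambda> m. ?c \<Delta>2' \<sigma>}"
  define suff where "suff \<sigma> = {\<omega>. \<sigma> @ \<omega> \<in> \<Lambda> (m + n)}" for \<sigma>
  define I where "I = Sigma A (\<lambda>\<sigma>. edge_paths m \<Delta>1' n) \<union> Sigma C suff"
  have fin: "finite A" "finite C" "finite (suff \<sigma>)" for \<sigma>
    using finite_\<Lambda> finite_vimageI[of "\<Lambda> (m + n)" "(@) \<sigma>"]
    by (auto simp: A_def C_def suff_def vimage_def inj_def)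
  have suff_lists: "suff \<sigma> \<subseteq> lists {..k}" for \<sigma> by (auto simp: suff_def dest!: \<Lambda>_lists)
  have finI: "finite I" unfolding I_def using fin finite_edge_paths by auto
  have nonneg: "0 \<le> p_word (fst x @ snd x)" if "x \<in> I" for x
  proof -
    have "fst x \<in> \<Lambda> m" "snd x \<in> edge_paths m \<Delta>1' n \<or> snd x \<in> suff (fst x)"
      using that by (auto simp: I_def A_def C_def)
    then have "fst x @ snd x \<in> lists {..k}"
      using \<Lambda>_lists[of "fst x" m] edge_paths_lists[of "snd x" m "\<Delta>1'" n] suff_lists[of "fst x"] by auto
    then show ?thesis by (rule less_imp_le[OF p_word_pos])
  qed
  have sub: "{\<sigma> \<in> \<Lambda> (m + n). ?c \<Delta>1 \<sigma> \<and> \<not> ?c \<Delta>2 \<sigma>} \<subseteq> (\<lambda>x. fst x @ snd x) ` I"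
  proof
    fix \<tau> assume \<tau>: "\<tau> \<in> {\<sigma> \<in> \<Lambda> (m + n). ?c \<Delta>1 \<sigma> \<and> \<not> ?c \<Delta>2 \<sigma>}"
    then obtain \<sigma> \<omega> where \<sigma>: "\<sigma> \<in> \<Lambda> m" "\<tau> = \<sigma> @ \<omega>" using \<Lambda>_has_prefix[OF \<Delta>(3)] by blast
    have cov: "?c \<Delta>1' \<sigma>" using prefix_covers_parent[OF \<Delta>(1) \<Delta>'(1) \<Delta>(3) \<Delta>'(3) \<sigma>(1)] \<tau> \<sigma> by blast
    have "(\<sigma>, \<omega>) \<in> I"
    proof (cases "?c \<Delta>2' \<sigma>")
      case True
      then show ?thesis using \<sigma> \<tau> by (simp add: I_def C_def suff_def)
    next
      case False
      then have "\<omega> \<in> edge_paths m \<Delta>1' n"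
        using separating_suffix_is_edge_path[OF \<Delta> \<Delta>' \<sigma>(1)] \<tau> \<sigma> by blast
      then show ?thesis using \<sigma> cov False by (simp add: I_def A_def)
    qed
    then show "\<tau> \<in> (\<lambda>x. fst x @ snd x) ` I" using \<sigma>(2) by (intro image_eqI[of _ _ "(\<sigma>, \<omega>)"]) simp_all
  qed
  have "excess (m + n) \<Delta>1 \<Delta>2 \<le> sum p_word ((\<lambda>x. fst x @ snd x) ` I)"
    unfolding excess_def using sub finI nonneg by (intro sum_mono2) auto
  also have "\<dots> \<le> (\<Sum>x\<in>I. p_word (fst x @ snd x))"
    using sum_image_le[OF finI, of p_word "\<lambda>x. fst x @ snd x"] nonneg by (simp add: o_def)
  also have "\<dots> = (\<Sum>x\<in>Sigma A (\<lambda>\<sigma>. edge_paths m \<Delta>1' n). p_word (fst x @ snd x))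
      + (\<Sum>x\<in>Sigma C suff. p_word (fst x @ snd x))"
    unfolding I_def using fin finite_edge_paths
    by (intro sum.union_disjoint finite_SigmaI) (auto simp: A_def C_def)
  also have "\<dots> = (\<Sum>\<sigma>\<in>A. \<Sum>\<omega>\<in>edge_paths m \<Delta>1' n. p_word \<sigma> * p_word \<omega>)
      + (\<Sum>\<sigma>\<in>C. \<Sum>\<omega>\<in>suff \<sigma>. p_word \<sigma> * p_word \<omega>)"
    using fin finite_edge_paths by (simp add: sum.Sigma p_word_append case_prod_beta)
  also have "\<dots> = \<Gamma> m \<Delta>1' n * excess m \<Delta>1' \<Delta>2' + (\<Sum>\<sigma>\<in>C. p_word \<sigma> * (\<Sum>\<omega>\<in>suff \<sigma>. p_word \<omega>))"
    by (simp add: \<Gamma>_def excess_def A_def sum_distrib_left[symmetric] sum_distrib_right[symmetric] mult.commute)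
  also have "(\<Sum>\<sigma>\<in>C. p_word \<sigma> * (\<Sum>\<omega>\<in>suff \<sigma>. p_word \<omega>)) \<le> (\<Sum>\<sigma>\<in>C. p_word \<sigma> * 1)"
    using sum_suffixes_le_1 p_word_pos \<Lambda>_lists unfolding suff_def C_def
    by (intro sum_mono mult_left_mono) (auto intro: less_imp_le)
  finally show ?thesis by (simp add: P_def C_def)
qed


section \<open>Generalized regularity bounds the growth of the excess\<close>

lemma ennreal_inverse_antimono: "x \<le> y \<Longrightarrow> inverse y \<le> inverse (x :: ennreal)"
  by (simp add: less_eq_ennreal.rep_eq inverse_ennreal.rep_eq ereal_inverse_antimono)

text \<open>The second bound makes one pass through the recursion cost a factor of at most
  \<^term>\<open>q ^ N\<close>. Finiteness of \<^term>\<open>B N\<close> also yields the first bound, because some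
  \<open>\<Gamma>\<close> is positive: there is an edge path of \<open>[0,1]\<close> of every generation.\<close>

lemma generalized_regular_bounds:
  assumes "generalized_regular" "q > 1"
  obtains N C where "N \<ge> 1" "C > 0"
    "\<And>m \<Delta> \<Delta>'. \<lbrakk>m \<ge> 1; \<Delta> \<in> net_intervals m; \<Delta>' \<in> net_intervals (m + N); \<Delta>' \<subseteq> \<Delta>\<rbrakk>
       \<Longrightarrow> P m \<Delta> \<le> C * P (m + N) \<Delta>'"
    "\<And>m \<Delta> \<Delta>' \<Delta>''. \<lbrakk>m \<ge> 1; \<Delta> \<in> net_intervals m; \<Delta>' \<in> net_intervals (m + N); \<Delta>' \<subseteq> \<Delta>;
        \<Delta>'' \<in> net_intervals m\<rbrakk> \<Longrightarrow> \<Gamma> m \<Delta>'' N * P m \<Delta> \<le> q ^ N * P (m + N) \<Delta>'"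
proof -
  have "(\<lambda>n. B n / ennreal (q ^ n)) \<longlonglongrightarrow> 0" using assms by (simp add: generalized_regular_def)
  then have "\<forall>\<^sub>F n in sequentially. B n / ennreal (q ^ n) < 1" by (rule order_tendstoD) simp
  then obtain N0 where "\<And>n. n \<ge> N0 \<Longrightarrow> B n / ennreal (q ^ n) < 1"
    by (auto simp: eventually_sequentially)
  then have "B (max N0 1) / ennreal (q ^ max N0 1) < 1" by simp
  then obtain N where N: "B N / ennreal (q ^ N) < 1" "N \<ge> 1" using max.cobounded2 by blast
  define G where "G = Sup {ennreal (\<Gamma> m \<Delta> N) | m \<Delta>. \<Delta> \<in> net_intervals m}"
  have qN: "q ^ N > 0" using assms(2) by simp
  have BN: "B N \<le> ennreal (q ^ N)"
  proof (rule ccontr)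
    assume "\<not> B N \<le> ennreal (q ^ N)"
    then have "ennreal (q ^ N) / ennreal (q ^ N) \<le> B N / ennreal (q ^ N)"
      by (intro divide_right_mono_ennreal) auto
    moreover have "ennreal (q ^ N) / ennreal (q ^ N) = 1" using assms(2) by (subst divide_ennreal) auto
    ultimately show False using N by simp
  qed
  have \<Gamma>_le: "ennreal (\<Gamma> m \<Delta> N) \<le> G" if "\<Delta> \<in> net_intervals m" for m \<Delta>
    unfolding G_def using that by (intro Sup_upper) auto
  have "\<Gamma> 0 {0..1} N > 0"
    unfolding \<Gamma>_def using finite_edge_paths unit_interval_has_edge_path[OF N(2)] edge_paths_lists p_word_pos
    by (intro sum_pos) auto
  then have "G \<noteq> 0" using \<Gamma>_le[of "{0..1}" 0] by (auto simp: net_intervals_def)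
  then have "1 / R N \<noteq> \<infinity>"
    using BN by (auto simp: B_def G_def[symmetric] ennreal_top_mult top_unique)
  then obtain C0 where C0: "C0 \<ge> 0" "1 / R N = ennreal C0" by (cases "1 / R N") auto
  have ratio_le: "ennreal (P m \<Delta> / P (m + N) \<Delta>') \<le> 1 / R N"
    if *: "m \<ge> 1" "\<Delta> \<in> net_intervals m" "\<Delta>' \<in> net_intervals (m + N)" "\<Delta>' \<subseteq> \<Delta>" for m \<Delta> \<Delta>'
  proof -
    have pos: "P m \<Delta> > 0" "P (m + N) \<Delta>' > 0" using P_pos * by auto
    have "R N \<le> ennreal (P (m + N) \<Delta>' / P m \<Delta>)"
      unfolding R_def using * by (intro Inf_lower) blast
    then have "1 / ennreal (P (m + N) \<Delta>' / P m \<Delta>) \<le> 1 / R N"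
      by (simp add: divide_ennreal_def ennreal_inverse_antimono)
    moreover have "1 / ennreal (P (m + N) \<Delta>' / P m \<Delta>) = ennreal (P m \<Delta> / P (m + N) \<Delta>')"
      using pos divide_ennreal[of 1 "P (m + N) \<Delta>' / P m \<Delta>"] by simp
    ultimately show ?thesis by simp
  qed
  show thesis
  proof (rule that[of N "C0 + 1"])
    show "N \<ge> 1" "C0 + 1 > 0" using N C0 by auto
  next
    fix m \<Delta> \<Delta>'
    assume *: "m \<ge> 1" "\<Delta> \<in> net_intervals m" "\<Delta>' \<in> net_intervals (m + N)" "\<Delta>' \<subseteq> \<Delta>"
    have pos: "P (m + N) \<Delta>' > 0" using P_pos * by auto
    have "P m \<Delta> / P (m + N) \<Delta>' \<le> C0" using ratio_le[OF *] C0 by simp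
    then show "P m \<Delta> \<le> (C0 + 1) * P (m + N) \<Delta>'" using pos by (simp add: divide_le_eq algebra_simps)
  next
    fix m \<Delta> \<Delta>' \<Delta>''
    assume *: "m \<ge> 1" "\<Delta> \<in> net_intervals m" "\<Delta>' \<in> net_intervals (m + N)" "\<Delta>' \<subseteq> \<Delta>"
      and \<Delta>'': "\<Delta>'' \<in> net_intervals m"
    have pos: "P m \<Delta> > 0" "P (m + N) \<Delta>' > 0" using P_pos * by auto
    have "ennreal (P m \<Delta> / P (m + N) \<Delta>' * \<Gamma> m \<Delta>'' N) \<le> 1 / R N * G"
      using pos \<Gamma>_nonneg by (subst ennreal_mult) (auto intro!: mult_mono ratio_le[OF *] \<Gamma>_le[OF \<Delta>''])
    also have "\<dots> \<le> ennreal (q ^ N)" using BN by (simp add: B_def G_def)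
    finally have "P m \<Delta> / P (m + N) \<Delta>' * \<Gamma> m \<Delta>'' N \<le> q ^ N" using qN by simp
    then show "\<Gamma> m \<Delta>'' N * P m \<Delta> \<le> q ^ N * P (m + N) \<Delta>'"
      using pos by (simp add: divide_le_eq mult.commute)
  qed
qed

lemma P_bounded_below:
  obtains M where "M \<ge> 0" "\<And>n \<Delta>. \<lbrakk>n \<ge> 1; n \<le> N; \<Delta> \<in> net_intervals n\<rbrakk> \<Longrightarrow> 1 \<le> M * P n \<Delta>"
proof -
  define M where "M = (\<Sum>n = 1..N. \<Sum>\<Delta>\<in>net_intervals n. 1 / P n \<Delta>)"
  have pos: "1 / P n \<Delta> \<ge> 0" if "n \<ge> 1" "\<Delta> \<in> net_intervals n" for n \<Delta>
    using P_pos that by (simp add: less_imp_le)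
  show thesis
  proof (rule that[of M])
    show "M \<ge> 0" unfolding M_def using pos by (intro sum_nonneg) auto
    fix n \<Delta> assume n: "n \<ge> 1" "n \<le> N" and \<Delta>: "\<Delta> \<in> net_intervals n"
    have "1 / P n \<Delta> \<le> (\<Sum>\<Delta>\<in>net_intervals n. 1 / P n \<Delta>)"
      using n \<Delta> pos by (intro member_le_sum finite_net_intervals) auto
    also have "\<dots> \<le> M"
      unfolding M_def using n pos by (intro member_le_sum[of n "{1..N}"] sum_nonneg) auto
    finally show "1 \<le> M * P n \<Delta>" using P_pos[OF \<Delta> n(1)] by (simp add: divide_le_eq)
  qed
qed

text \<open>Iterating the recursion over steps of length \<open>N\<close>. The constant \<^term>\<open>C / (q ^ N - 1)\<close> is the
  fixed point of the recursion \<open>x = q ^ N * x - C\<close>; subtracting it from \<open>A * q ^ n\<close> absorbs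
  the additive term that arises in each step.\<close>

lemma excess_growth:
  assumes "generalized_regular" "q > 1"
  obtains A where "A \<ge> 0" "\<And>n \<Delta>1 \<Delta>2. \<lbrakk>n \<ge> 1; \<Delta>1 \<in> net_intervals n; \<Delta>2 \<in> net_intervals n;
     adjacent \<Delta>1 \<Delta>2\<rbrakk> \<Longrightarrow> excess n \<Delta>1 \<Delta>2 \<le> A * q ^ n * P n \<Delta>2"
proof -
  obtain N C where N: "N \<ge> 1" "C > 0"
    and C: "\<And>m \<Delta> \<Delta>'. \<lbrakk>m \<ge> 1; \<Delta> \<in> net_intervals m; \<Delta>' \<in> net_intervals (m + N); \<Delta>' \<subseteq> \<Delta>\<rbrakk>
       \<Longrightarrow> P m \<Delta> \<le> C * P (m + N) \<Delta>'"
    and \<Gamma>: "\<And>m \<Delta> \<Delta>' \<Delta>''. \<lbrakk>m \<ge> 1; \<Delta> \<in> net_intervals m; \<Delta>' \<in> net_intervals (m + N); \<Delta>' \<subseteq> \<Delta>;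
        \<Delta>'' \<in> net_intervals m\<rbrakk> \<Longrightarrow> \<Gamma> m \<Delta>'' N * P m \<Delta> \<le> q ^ N * P (m + N) \<Delta>'"
    using generalized_regular_bounds[OF assms] by blast
  obtain M where M: "M \<ge> 0" "\<And>n \<Delta>. \<lbrakk>n \<ge> 1; n \<le> N; \<Delta> \<in> net_intervals n\<rbrakk> \<Longrightarrow> 1 \<le> M * P n \<Delta>"
    using P_bounded_below by blast
  have qN: "q ^ N > 1" using assms(2) N by (intro one_less_power) auto
  define G where "G = C / (q ^ N - 1)"
  have G: "G > 0" "q ^ N * G = G + C" using N qN by (auto simp: G_def field_simps)
  define A where "A = M + G"
  have X_ge: "M \<le> A * q ^ n - G" for n
  proof -
    have "A * 1 \<le> A * q ^ n" using assms(2) M G by (intro mult_left_mono one_le_power) (auto simp: A_def)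
    then show ?thesis by (simp add: A_def)
  qed
  have main: "excess n \<Delta>1 \<Delta>2 \<le> (A * q ^ n - G) * P n \<Delta>2"
    if "n \<ge> 1" "\<Delta>1 \<in> net_intervals n" "\<Delta>2 \<in> net_intervals n" "adjacent \<Delta>1 \<Delta>2" for n \<Delta>1 \<Delta>2
    using that
  proof (induction n arbitrary: \<Delta>1 \<Delta>2 rule: less_induct)
    case (less n)
    have pos: "P n \<Delta>2 > 0" using P_pos less.prems by blast
    show ?case
    proof (cases "n \<le> N")
      case True
      have "excess n \<Delta>1 \<Delta>2 \<le> 1" by (rule excess_le_1)
      also have "1 \<le> M * P n \<Delta>2" using M True less.prems by blast
      also have "\<dots> \<le> (A * q ^ n - G) * P n \<Delta>2" using X_ge pos by (intro mult_right_mono) auto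
      finally show ?thesis .
    next
      case False
      define m where "m = n - N"
      have m: "m \<ge> 1" "m < n" "n = m + N" using False N by (auto simp: m_def)
      define X where "X = A * q ^ m - G"
      have X: "X \<ge> 0" using X_ge[of m] M(1) by (simp add: X_def)
      obtain \<Delta>1' where 1: "\<Delta>1' \<in> net_intervals m" "\<Delta>1 \<subseteq> \<Delta>1'"
        using net_interval_parent[of \<Delta>1 m N] less.prems(2) m by blast
      obtain \<Delta>2' where 2: "\<Delta>2' \<in> net_intervals m" "\<Delta>2 \<subseteq> \<Delta>2'"
        using net_interval_parent[of \<Delta>2 m N] less.prems(3) m by blast
      have adj: "adjacent \<Delta>1' \<Delta>2'"
        using adjacent_parents less.prems 1 2 m by blast
      have "excess n \<Delta>1 \<Delta>2 \<le> \<Gamma> m \<Delta>1' N * excess m \<Delta>1' \<Delta>2' + P m \<Delta>2'"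
        using excess_recursion less.prems 1 2 m by blast
      also have "\<dots> \<le> \<Gamma> m \<Delta>1' N * (X * P m \<Delta>2') + C * P n \<Delta>2"
        using less.IH[OF m(2,1) 1(1) 2(1) adj] C[OF m(1) 2(1) _ 2(2)] less.prems m \<Gamma>_nonneg
        by (intro add_mono mult_left_mono) (auto simp: X_def)
      also have "\<Gamma> m \<Delta>1' N * (X * P m \<Delta>2') = X * (\<Gamma> m \<Delta>1' N * P m \<Delta>2')" by simp
      also have "\<dots> \<le> X * (q ^ N * P n \<Delta>2)"
        using \<Gamma>[OF m(1) 2(1) _ 2(2) 1(1)] less.prems m X by (intro mult_left_mono) auto
      also have "X * (q ^ N * P n \<Delta>2) + C * P n \<Delta>2 = (A * q ^ n - q ^ N * G + C) * P n \<Delta>2"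
        by (simp add: X_def m(3) power_add algebra_simps)
      also have "\<dots> = (A * q ^ n - G) * P n \<Delta>2" by (simp add: G(2))
      finally show ?thesis by simp
    qed
  qed
  show thesis
  proof (rule that[of A])
    show "A \<ge> 0" using M G by (simp add: A_def)
    fix n \<Delta>1 \<Delta>2
    assume *: "n \<ge> 1" "\<Delta>1 \<in> net_intervals n" "\<Delta>2 \<in> net_intervals n" "adjacent \<Delta>1 \<Delta>2"
    have "0 \<le> G * P n \<Delta>2" using G P_pos * by (simp add: less_imp_le)
    then show "excess n \<Delta>1 \<Delta>2 \<le> A * q ^ n * P n \<Delta>2" using main[OF *] by (simp add: algebra_simps)
  qed
qed

lemma generalized_regular_imp_comparable:
  assumes "generalized_regular"
  shows "comparable"
  unfolding comparable_def
proof (intro allI impI)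
  fix q :: real assume q: "q > 1"
  obtain A where A: "A \<ge> 0" "\<And>n \<Delta>1 \<Delta>2. \<lbrakk>n \<ge> 1; \<Delta>1 \<in> net_intervals n; \<Delta>2 \<in> net_intervals n;
     adjacent \<Delta>1 \<Delta>2\<rbrakk> \<Longrightarrow> excess n \<Delta>1 \<Delta>2 \<le> A * q ^ n * P n \<Delta>2"
    using excess_growth[OF assms q] by blast
  have upper: "P n \<Delta>1 \<le> (1 + A) * q ^ n * P n \<Delta>2"
    if *: "n \<ge> 1" "\<Delta>1 \<in> net_intervals n" "\<Delta>2 \<in> net_intervals n" "adjacent \<Delta>1 \<Delta>2" for n \<Delta>1 \<Delta>2
  proof -
    have "1 * P n \<Delta>2 \<le> q ^ n * P n \<Delta>2"
      using q P_pos[OF *(3,1)] by (intro mult_right_mono one_le_power) auto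
    then show ?thesis using P_le_P_plus_excess[of n \<Delta>1 \<Delta>2] A(2)[OF *] by (simp add: algebra_simps)
  qed
  show "\<exists>c>0. \<forall>n\<ge>1. \<forall>\<Delta>1\<in>net_intervals n. \<forall>\<Delta>2\<in>net_intervals n. adjacent \<Delta>1 \<Delta>2 \<longrightarrow>
       1 / c * (1 / q ^ n) * P n \<Delta>2 \<le> P n \<Delta>1 \<and> P n \<Delta>1 \<le> c * q ^ n * P n \<Delta>2"
  proof (intro exI[of _ "1 + A"] conjI allI ballI impI)
    show "0 < 1 + A" using A by simp
    fix n \<Delta>1 \<Delta>2
    assume *: "n \<ge> 1" "\<Delta>1 \<in> net_intervals n" "\<Delta>2 \<in> net_intervals n" "adjacent \<Delta>1 \<Delta>2"
    show "P n \<Delta>1 \<le> (1 + A) * q ^ n * P n \<Delta>2" using upper * by blast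
    have "P n \<Delta>2 \<le> (1 + A) * q ^ n * P n \<Delta>1" using upper * adjacent_sym by blast
    moreover have "(1 + A) * q ^ n > 0" using A q by simp
    ultimately have "P n \<Delta>2 / ((1 + A) * q ^ n) \<le> P n \<Delta>1" by (simp add: divide_le_eq mult.commute)
    then show "1 / (1 + A) * (1 / q ^ n) * P n \<Delta>2 \<le> P n \<Delta>1" by simp
  qed
qed

end

theorem theorem4p11:
  fixes k :: nat and r d p :: "nat \<Rightarrow> real" and K :: "real set" and \<mu> :: "real measure"
  assumes "self_similar_measure k r d K p \<mu>"
    and "self_similar_set.finite_type k r d"
    and "self_similar_measure.generalized_regular k r d K p"
  shows "self_similar_measure.comparable k r d K p"
  using self_similar_measure.generalized_regular_imp_comparable assms by blast

end
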